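(* Suppose $\gamma:\mathbb{R}\to\mathbb{R}^2$ is a smooth open rotator for the curve diffusion flow, with associated $S\in\mathbb{R}$, satisfying $$\lim_{i\to\infty}\Big[\big(\kappa(p_i)\kappa_s(p_i)-2S\langle\nu(p_i),\gamma(p_i)\rangle\big)-\big(\kappa(q_i)\kappa_s(q_i)-2S\langle\nu(q_i),\gamma(q_i)\rangle\big)\Big]=0$$ for arbitrary sequences $\{p_i\}$ and $\{q_i\}$ asymptotic to $-\infty$ and $+\infty$ respectively. Then $\gamma(\mathbb{R})$ is a straight line.
   Context: All curves are smooth and regular. $s$ denotes arc length along $\gamma$, $\nu$ a choice of unit normal, and $\kappa=\langle\gamma_{ss},\nu\rangle$ the curvature. The curve diffusion flow is $\langle\partial_t\gamma,\nu\rangle=-\kappa_{ss}$. An open curve is a regular immersion $\gamma:\mathbb{R}\to\mathbb{R}^2$ for which there does not exist a pair of intervals $I,J$ with $I\cap J=\emptyset$, $|I|=\infty$, $|J|<\infty$ and $\gamma(I)=\gamma(J)$. A rotator (a solution evolving purely by rotation) is a curve satisfying $-\kappa_{ss}\equiv2S\langle\gamma_s,\gamma\rangle$, where $S$ depends only on time along the flow and so is a constant along each fixed curve.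
   Formalization: The curve is additionally assumed to be complete (both ends have infinite arc length); otherwise an open arc of a circle centred at the origin, parametrised over all of R, satisfies every hypothesis without being a line. *)

theory Defs
  imports "HOL-Analysis.Analysis"
begin

definition smooth :: "(real \<Rightarrow> 'a::real_normed_vector) \<Rightarrow> bool" where
  "smooth f \<longleftrightarrow>
     (\<forall>n. ((\<lambda>g u. vector_derivative g (at u)) ^^ n) f differentiable_on UNIV)"

definition speed :: "(real \<Rightarrow> real^2) \<Rightarrow> real \<Rightarrow> real" where
  "speed \<gamma> u = norm (vector_derivative \<gamma> (at u))"

definition regular_immersion :: "(real \<Rightarrow> real^2) \<Rightarrow> bool" where
  "regular_immersion \<gamma> \<longleftrightarrow> smooth \<gamma> \<and> (\<forall>u. vector_derivative \<gamma> (at u) \<noteq> 0)"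

(* The arc length derivative f_s along \<gamma>; the parameter u of \<gamma> itself need not be arc length. *)
definition ds :: "(real \<Rightarrow> real^2) \<Rightarrow> (real \<Rightarrow> 'a::real_normed_vector) \<Rightarrow> real \<Rightarrow> 'a" where
  "ds \<gamma> f u = (1 / speed \<gamma> u) *\<^sub>R vector_derivative f (at u)"

definition unit_normal :: "(real \<Rightarrow> real^2) \<Rightarrow> (real \<Rightarrow> real^2) \<Rightarrow> bool" where
  "unit_normal \<gamma> \<nu> \<longleftrightarrow>
     continuous_on UNIV \<nu> \<and> (\<forall>u. norm (\<nu> u) = 1 \<and> \<nu> u \<bullet> ds \<gamma> \<gamma> u = 0)"

definition curvature :: "(real \<Rightarrow> real^2) \<Rightarrow> (real \<Rightarrow> real^2) \<Rightarrow> real \<Rightarrow> real" where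
  "curvature \<gamma> \<nu> u = ds \<gamma> (ds \<gamma> \<gamma>) u \<bullet> \<nu> u"

(* Both ends have infinite length, i.e. arc length takes all values in (-\<infinity>, \<infinity>). An immersion
   of the parameter line need not have this property: it can trace a bounded arc of a circle. *)
definition complete_curve :: "(real \<Rightarrow> real^2) \<Rightarrow> bool" where
  "complete_curve \<gamma> \<longleftrightarrow>
     filterlim (\<lambda>b. integral {0..b} (speed \<gamma>)) at_top at_top \<and>
     filterlim (\<lambda>a. integral {a..0} (speed \<gamma>)) at_top at_bot"

definition open_curve :: "(real \<Rightarrow> real^2) \<Rightarrow> bool" where
  "open_curve \<gamma> \<longleftrightarrow> regular_immersion \<gamma> \<and>
     \<not> (\<exists>I J. is_interval I \<and> is_interval J \<and> I \<inter> J = {} \<and>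
            emeasure lborel I = \<infinity> \<and> emeasure lborel J < \<infinity> \<and> \<gamma> ` I = \<gamma> ` J)"

definition rotator :: "(real \<Rightarrow> real^2) \<Rightarrow> (real \<Rightarrow> real^2) \<Rightarrow> real \<Rightarrow> bool" where
  "rotator \<gamma> \<nu> S \<longleftrightarrow>
     (\<forall>u. - ds \<gamma> (ds \<gamma> (curvature \<gamma> \<nu>)) u = 2 * S * (ds \<gamma> \<gamma> u \<bullet> \<gamma> u))"

definition end_quantity :: "(real \<Rightarrow> real^2) \<Rightarrow> (real \<Rightarrow> real^2) \<Rightarrow> real \<Rightarrow> real \<Rightarrow> real" where
  "end_quantity \<gamma> \<nu> S u =
     curvature \<gamma> \<nu> u * ds \<gamma> (curvature \<gamma> \<nu>) u - 2 * S * (\<nu> u \<bullet> \<gamma> u)"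

definition straight_line :: "(real^2) set \<Rightarrow> bool" where
  "straight_line L \<longleftrightarrow> affine L \<and> aff_dim L = 1"

end

theory Submission
  imports Defs
begin

text \<open>
  The Frenet equations and the rotator equation give
  \<open>(\<kappa> \<kappa>\<^sub>s - 2 S \<langle>\<nu>, \<gamma>\<rangle>)\<^sub>s = \<kappa>\<^sub>s\<^sup>2\<close>, so the end quantity is monotone. As its limits at
  the two ends agree, it is constant, hence \<open>\<kappa>\<close> is constant. If \<open>\<kappa> \<noteq> 0\<close>, then \<open>\<gamma>\<close> winds
  infinitely often around a circle in each direction, and a half-line has the same image as a
  bounded interval preceding it, which openness forbids. Therefore \<open>\<kappa> = 0\<close>, and completeness
  makes the image a full line.
\<close>

subsection \<open>Smooth functions of a real variable\<close>

text \<open>Smoothness up to a finite order, peeling off the innermost derivative. This form suits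
  induction on the order with the function generalized, which is how all closure properties below
  are obtained.\<close>

primrec diff_upto :: "nat \<Rightarrow> (real \<Rightarrow> 'a::real_normed_vector) \<Rightarrow> bool" where
  "diff_upto 0 f \<longleftrightarrow> True"
| "diff_upto (Suc n) f \<longleftrightarrow>
     (\<forall>u. f differentiable (at u)) \<and> diff_upto n (\<lambda>u. vector_derivative f (at u))"

lemma diff_upto_iff:
  "diff_upto n f \<longleftrightarrow> (\<forall>k<n. ((\<lambda>g u. vector_derivative g (at u)) ^^ k) f differentiable_on UNIV)"
proof (induction n arbitrary: f)
  case (Suc n)
  then show ?case
    by (simp add: All_less_Suc2 funpow_Suc_right differentiable_on_def del: funpow.simps)
qed simp

lemma smooth_iff_diff_upto: "smooth f \<longleftrightarrow> (\<forall>n. diff_upto n f)"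
  unfolding smooth_def diff_upto_iff by blast

lemma smooth_has_vector_derivative:
  assumes "smooth f"
  shows "(f has_vector_derivative vector_derivative f (at u)) (at u)"
proof -
  have "diff_upto (Suc 0) f"
    using assms by (simp only: smooth_iff_diff_upto)
  then show ?thesis
    by (simp add: vector_derivative_works)
qed

lemma smooth_vector_derivative:
  assumes "smooth f"
  shows "smooth (\<lambda>u. vector_derivative f (at u))"
  using assms unfolding smooth_iff_diff_upto by (metis diff_upto.simps(2))

lemma diff_upto_SucI:
  assumes "\<And>u. (f has_vector_derivative f' u) (at u)" and "diff_upto n f'"
  shows "diff_upto (Suc n) f"
proof -
  have "(\<lambda>u. vector_derivative f (at u)) = f'"
    using assms(1) vector_derivative_at by blast
  moreover have "f differentiable (at u)" for u
    using assms(1) by (rule differentiableI_vector)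
  ultimately show ?thesis
    using assms(2) by simp
qed

lemma diff_upto_SucD:
  assumes "diff_upto (Suc n) f"
  shows "(f has_vector_derivative vector_derivative f (at u)) (at u)"
    and "diff_upto n (\<lambda>u. vector_derivative f (at u))"
  using assms by (simp_all add: vector_derivative_works)

lemma diff_upto_pred: "diff_upto (Suc n) f \<Longrightarrow> diff_upto n f"
  by (simp only: diff_upto_iff) simp

lemma diff_upto_add:
  assumes "diff_upto n f" and "diff_upto n g"
  shows "diff_upto n (\<lambda>u. f u + g u)"
  using assms
proof (induction n arbitrary: f g)
  case (Suc n)
  show ?case
    by (rule diff_upto_SucI[OF has_vector_derivative_add])
      (use Suc.prems[THEN diff_upto_SucD(1)] Suc.prems[THEN diff_upto_SucD(2)] Suc.IH in auto)
qed simp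

text \<open>The Leibniz rule expresses the derivative as a sum of two terms of the same bilinear
  shape, so the induction must range over both factors. One proof covers inner products, scalar
  multiples and real products.\<close>

lemma diff_upto_bilinear:
  assumes "bounded_bilinear b" and "diff_upto n f" and "diff_upto n g"
  shows "diff_upto n (\<lambda>u. b (f u) (g u))"
  using assms(2,3)
proof (induction n arbitrary: f g)
  case (Suc n)
  note D = Suc.prems[THEN diff_upto_SucD(1)] Suc.prems[THEN diff_upto_SucD(2)]
  show ?case
  proof (rule diff_upto_SucI)
    show "((\<lambda>u. b (f u) (g u)) has_vector_derivative
        b (f u) (vector_derivative g (at u)) + b (vector_derivative f (at u)) (g u)) (at u)"
      for u
      by (rule bounded_bilinear.has_vector_derivative[OF assms(1) D(1,2)])
    show "diff_upto n (\<lambda>u. b (f u) (vector_derivative g (at u)) +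
        b (vector_derivative f (at u)) (g u))"
      using Suc.prems[THEN diff_upto_pred] D(3,4)
      by (intro diff_upto_add Suc.IH)
  qed
qed simp

lemma smooth_bilinear:
  assumes "bounded_bilinear b" and "smooth f" and "smooth g"
  shows "smooth (\<lambda>u. b (f u) (g u))"
  using assms diff_upto_bilinear unfolding smooth_iff_diff_upto by blast

lemmas smooth_inner = smooth_bilinear[OF bounded_bilinear_inner]
lemmas smooth_scaleR = smooth_bilinear[OF bounded_bilinear_scaleR]

lemma diff_upto_bounded_linear:
  assumes "bounded_linear h" and "diff_upto n f"
  shows "diff_upto n (\<lambda>u. h (f u))"
  using assms(2)
proof (induction n arbitrary: f)
  case (Suc n)
  show ?case
    by (rule diff_upto_SucI[OF bounded_linear.has_vector_derivative[OF assms(1)]])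
      (use diff_upto_SucD[OF Suc.prems] Suc.IH in auto)
qed simp

lemma smooth_bounded_linear:
  assumes "bounded_linear h" and "smooth f"
  shows "smooth (\<lambda>u. h (f u))"
  using assms diff_upto_bounded_linear unfolding smooth_iff_diff_upto by blast

lemma continuous_on_smooth: "smooth f \<Longrightarrow> continuous_on A f"
  by (meson continuous_at_imp_continuous_on has_vector_derivative_continuous
      smooth_has_vector_derivative)

section \<open>Constancy of functions from their derivatives and end behaviour\<close>

lemma zero_vector_derivative_imp_const:
  fixes f :: "real \<Rightarrow> 'a::real_normed_vector"
  assumes "\<And>u. (f has_vector_derivative 0) (at u)"
  shows "f u = f v"
proof -
  obtain c where "\<And>x. x \<in> UNIV \<Longrightarrow> f x = c"
    using assms has_vector_derivative_zero_constant[of UNIV f] by auto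
  then show ?thesis by simp
qed

text \<open>For nondecreasing \<open>f\<close> and fixed \<open>x\<close>, \<open>y\<close>, the
  difference \<open>f (- real i) - f (real i)\<close> is eventually at most
  \<open>f x - f y\<close>. Passing to the limit gives \<open>0 \<le> f x - f y\<close>.\<close>

lemma const_of_DERIV_nonneg_of_ends:
  fixes f f' :: "real \<Rightarrow> real"
  assumes der: "\<And>u. (f has_real_derivative f' u) (at u)"
    and nonneg: "\<And>u. 0 \<le> f' u"
    and ends: "(\<lambda>i. f (- real i) - f (real i)) \<longlonglongrightarrow> 0"
  shows "f' u = 0"
proof -
  have mono: "f x \<le> f y" if "x \<le> y" for x y
    using DERIV_nonneg_imp_nondecreasing[OF that] der nonneg by blast
  have le: "f y - f x \<le> 0" for x y
  proof -
    have "eventually (\<lambda>i. \<bar>x\<bar> + \<bar>y\<bar> \<le> real i) sequentially"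
      using filterlim_real_sequentially by (simp add: filterlim_at_top)
    then have "eventually (\<lambda>i. f (- real i) - f (real i) \<le> f x - f y) sequentially"
    proof eventually_elim
      case (elim i)
      then have "f (- real i) \<le> f x" "f y \<le> f (real i)"
        by (auto intro!: mono)
      then show ?case by simp
    qed
    then have "0 \<le> f x - f y"
      by (rule tendsto_upperbound[OF ends _ sequentially_bot])
    then show ?thesis by simp
  qed
  \<comment> \<open>The bound \<open>le\<close> holds for \<open>x\<close> and \<open>y\<close> in
    either order, so all values of \<open>f\<close> coincide.\<close>
  have "f = (\<lambda>_. f 0)"
    using le by (intro ext) (meson antisym diff_le_0_iff_le)
  then have "(f has_real_derivative 0) (at u)"
    by (metis DERIV_const)
  then show ?thesis
    using der DERIV_unique by blast
qed

subsection \<open>The Frenet frame of a plane curve\<close>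

text \<open>The counterclockwise quarter turn, that is multiplication by the imaginary unit. It
  turns the tangent into a reference normal that is visibly smooth.\<close>

definition rot :: "real^2 \<Rightarrow> real^2" where
  "rot v = vector [- v $ 2, v $ 1]"

lemma rot_nth [simp]: "rot v $ 1 = - v $ 2" "rot v $ 2 = v $ 1"
  by (simp_all add: rot_def)

lemma bounded_linear_rot: "bounded_linear rot"
  by (rule linear_conv_bounded_linear[THEN iffD1], rule linearI)
    (simp_all add: vec_eq_iff forall_2)

lemma inner_2: "(v::real^2) \<bullet> w = v $ 1 * w $ 1 + v $ 2 * w $ 2"
  by (simp add: inner_vec_def sum_2)

lemma rot_rot: "rot (rot v) = - v"
  by (simp add: vec_eq_iff forall_2)

text \<open>The vectors \<open>t\<close> and \<open>rot t\<close> form an orthonormal basis, and the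
  component of \<open>n\<close> along \<open>t\<close> vanishes. The length of \<open>n\<close> is
  left free because the lemma is applied to the derivative of the tangent as well as to the
  normal.\<close>

lemma unit_normal_eq_rot:
  fixes t n :: "real^2"
  assumes "t \<bullet> t = 1" and "n \<bullet> t = 0"
  shows "n = (n \<bullet> rot t) *\<^sub>R rot t"
proof -
  have 1: "t$1 * t$1 + t$2 * t$2 = 1" and 2: "n$1 * t$1 + n$2 * t$2 = 0"
    using assms by (simp_all add: inner_2)
  have "n$1 = (- n$1 * t$2 + n$2 * t$1) * - t$2" "n$2 = (- n$1 * t$2 + n$2 * t$1) * t$1"
    using 1 2 by algebra+
  then show ?thesis
    by (simp add: vec_eq_iff forall_2 inner_2)
qed

text \<open>The function r = 1 / \<open>speed \<gamma>\<close> solves r' =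
  -(\<open>\<gamma>\<close>' . \<open>\<gamma>\<close>'') r^3. The right-hand side is built from
  smooth functions and r itself, so each order of differentiability of r yields the next.\<close>

lemma smooth_inverse_speed:
  assumes "regular_immersion \<gamma>"
  shows "smooth (\<lambda>u. 1 / speed \<gamma> u)"
proof -
  let ?D = "\<lambda>u. vector_derivative \<gamma> (at u)"
  let ?D2 = "\<lambda>u. vector_derivative ?D (at u)"
  have sm: "smooth ?D" "smooth ?D2" and nz: "?D u \<noteq> 0" for u
    using assms smooth_vector_derivative unfolding regular_immersion_def by blast+
  have der: "((\<lambda>u. 1 / speed \<gamma> u) has_vector_derivative
      (- (?D u \<bullet> ?D2 u)) * ((1 / speed \<gamma> u) * ((1 / speed \<gamma> u) * (1 / speed \<gamma> u)))) (at u)" for u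
  proof -
    have "(?D has_derivative (\<lambda>h. h *\<^sub>R ?D2 u)) (at u)"
      using smooth_has_vector_derivative[OF sm(1)] by (simp add: has_vector_derivative_def)
    then have "((\<lambda>x. norm (?D x)) has_derivative (\<lambda>h. (h *\<^sub>R ?D2 u) \<bullet> sgn (?D u))) (at u)"
      by (rule has_derivative_compose) (rule has_derivative_norm[OF nz])
    moreover have "(\<lambda>h. (h *\<^sub>R ?D2 u) \<bullet> sgn (?D u)) = (*) (?D u \<bullet> ?D2 u / speed \<gamma> u)"
      by (simp add: fun_eq_iff sgn_div_norm speed_def field_simps inner_commute)
    ultimately have "(speed \<gamma> has_real_derivative ?D u \<bullet> ?D2 u / speed \<gamma> u) (at u)"
      unfolding has_field_derivative_def speed_def[abs_def] by simp
    moreover have "speed \<gamma> u \<noteq> 0"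
      using nz[of u] by (simp add: speed_def)
    ultimately show ?thesis
      unfolding has_real_derivative_iff_has_vector_derivative[symmetric]
      by (auto intro!: derivative_eq_intros simp: field_simps)
  qed
  have "diff_upto n (\<lambda>u. 1 / speed \<gamma> u)" for n
  proof (induction n)
    case (Suc n)
    have "diff_upto n (\<lambda>u. ?D u \<bullet> ?D2 u)"
      using smooth_inner[OF sm] by (simp add: smooth_iff_diff_upto)
    then have "diff_upto n (\<lambda>u. - (?D u \<bullet> ?D2 u))"
      by (rule diff_upto_bounded_linear[OF bounded_linear_minus[OF bounded_linear_ident]])
    then show ?case
      by (intro diff_upto_SucI[OF der] diff_upto_bilinear[OF bounded_bilinear_mult] Suc.IH)
  qed simp
  then show ?thesis
    by (simp add: smooth_iff_diff_upto)
qed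

lemma smooth_ds:
  assumes "regular_immersion \<gamma>" and "smooth f"
  shows "smooth (ds \<gamma> f)"
  using smooth_scaleR[OF smooth_inverse_speed smooth_vector_derivative, OF assms]
  unfolding ds_def[abs_def] .

lemma speed_pos:
  assumes "regular_immersion \<gamma>"
  shows "0 < speed \<gamma> u"
  using assms by (simp add: regular_immersion_def speed_def)

lemma has_vector_derivative_ds:
  assumes "regular_immersion \<gamma>" and "smooth f"
  shows "(f has_vector_derivative speed \<gamma> u *\<^sub>R ds \<gamma> f u) (at u)"
  using smooth_has_vector_derivative[OF assms(2), of u] speed_pos[OF assms(1), of u]
  by (simp add: ds_def)

lemma ds_eqI:
  assumes "regular_immersion \<gamma>" and "(f has_vector_derivative speed \<gamma> u *\<^sub>R v) (at u)"
  shows "ds \<gamma> f u = v"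
  using vector_derivative_at[OF assms(2)] speed_pos[OF assms(1), of u] by (simp add: ds_def)

section \<open>Frenet equations and monotonicity of the end quantity\<close>

locale framed_curve =
  fixes \<gamma> \<nu> :: "real \<Rightarrow> real^2"
  assumes regular: "regular_immersion \<gamma>" and normal: "unit_normal \<gamma> \<nu>"
begin

abbreviation \<tau> :: "real \<Rightarrow> real^2" where "\<tau> \<equiv> ds \<gamma> \<gamma>"
abbreviation \<kappa> :: "real \<Rightarrow> real" where "\<kappa> \<equiv> curvature \<gamma> \<nu>"

lemma smooth_curve: "smooth \<gamma>"
  using regular by (simp add: regular_immersion_def)

lemma smooth_tangent: "smooth \<tau>"
  by (rule smooth_ds[OF regular smooth_curve])

lemma tangent_unit: "\<tau> u \<bullet> \<tau> u = 1"
  using speed_pos[OF regular, of u]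
  by (simp add: ds_def speed_def dot_square_norm power2_eq_square)

lemma normal_unit: "\<nu> u \<bullet> \<nu> u = 1" and normal_orth: "\<nu> u \<bullet> \<tau> u = 0"
  using normal by (simp_all add: unit_normal_def dot_square_norm)

text \<open>Since \<open>\<nu>\<close> is a unit multiple of \<open>rot (\<tau> u)\<close>, the
  factor is 1 or -1. It depends continuously on the parameter, so it is constant on the connected
  line. This upgrades the continuous \<open>\<nu>\<close> to a smooth one.\<close>

lemma normal_eq_rot:
  obtains \<sigma> where "\<sigma> * \<sigma> = 1" and "\<nu> = (\<lambda>u. \<sigma> *\<^sub>R rot (\<tau> u))"
proof -
  let ?f = "\<lambda>u. \<nu> u \<bullet> rot (\<tau> u)"
  have eq: "\<nu> u = ?f u *\<^sub>R rot (\<tau> u)" for u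
    by (rule unit_normal_eq_rot[OF tangent_unit normal_orth])
  have rot_unit: "rot (\<tau> u) \<bullet> rot (\<tau> u) = 1" for u
    using tangent_unit[of u] by (simp add: inner_2 algebra_simps)
  have sq: "?f u * ?f u = 1" for u
    using normal_unit[of u] rot_unit[of u] eq[of u]
    by (metis inner_scaleR_left inner_commute)
  have "continuous_on UNIV ?f"
    using normal continuous_on_smooth[OF smooth_bounded_linear[OF bounded_linear_rot smooth_tangent]]
    by (auto intro!: continuous_on_inner simp: unit_normal_def)
  moreover have "?f ` UNIV \<subseteq> {-1, 1}"
    using sq by (auto simp: square_eq_1_iff)
  ultimately have "?f constant_on UNIV"
    by (intro continuous_finite_range_constant) (auto intro: finite_subset)
  then obtain \<sigma> where "\<And>u. ?f u = \<sigma>"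
    by (auto simp: constant_on_def)
  then show thesis
    using that[of \<sigma>] eq sq by (metis (no_types, lifting) ext)
qed

lemma smooth_normal: "smooth \<nu>"
proof -
  obtain \<sigma> where "\<nu> = (\<lambda>u. \<sigma> *\<^sub>R rot (\<tau> u))"
    using normal_eq_rot by metis
  then show ?thesis
    using smooth_bounded_linear[OF bounded_linear_const_scaleR[OF bounded_linear_rot] smooth_tangent]
    by simp
qed

lemma smooth_curvature: "smooth \<kappa>"
  using smooth_inner[OF smooth_ds[OF regular smooth_tangent] smooth_normal]
  unfolding curvature_def[abs_def] .

text \<open>First Frenet equation. Differentiating \<open>\<tau> u \<bullet> \<tau> u = 1\<close>
  shows that the derivative of the tangent is orthogonal to it, hence a multiple of the
  normal.\<close>

lemma ds_tangent: "ds \<gamma> \<tau> u = \<kappa> u *\<^sub>R \<nu> u"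
proof -
  have "((\<lambda>u. \<tau> u \<bullet> \<tau> u) has_vector_derivative
      \<tau> u \<bullet> (speed \<gamma> u *\<^sub>R ds \<gamma> \<tau> u) + (speed \<gamma> u *\<^sub>R ds \<gamma> \<tau> u) \<bullet> \<tau> u) (at u)"
    by (intro bounded_bilinear.has_vector_derivative[OF bounded_bilinear_inner]
        has_vector_derivative_ds regular smooth_tangent)
  moreover have "((\<lambda>u. \<tau> u \<bullet> \<tau> u) has_vector_derivative 0) (at u)"
    by (simp add: tangent_unit)
  ultimately have "\<tau> u \<bullet> (speed \<gamma> u *\<^sub>R ds \<gamma> \<tau> u) + (speed \<gamma> u *\<^sub>R ds \<gamma> \<tau> u) \<bullet> \<tau> u = 0"
    by (rule vector_derivative_unique_at)
  then have "ds \<gamma> \<tau> u \<bullet> \<tau> u = 0"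
    using speed_pos[OF regular, of u] by (simp add: inner_commute)
  then have *: "ds \<gamma> \<tau> u = (ds \<gamma> \<tau> u \<bullet> rot (\<tau> u)) *\<^sub>R rot (\<tau> u)"
    by (rule unit_normal_eq_rot[OF tangent_unit])
  obtain \<sigma> where "\<sigma> * \<sigma> = 1" "\<nu> = (\<lambda>u. \<sigma> *\<^sub>R rot (\<tau> u))"
    using normal_eq_rot by metis
  \<comment> \<open>The sign enters once through \<open>\<kappa>\<close> and once through
    \<open>\<nu>\<close>, so the product does not depend on the choice of normal.\<close>
  then have "\<kappa> u *\<^sub>R \<nu> u = (\<sigma> * \<sigma> * (ds \<gamma> \<tau> u \<bullet> rot (\<tau> u))) *\<^sub>R rot (\<tau> u)"
    by (simp add: curvature_def mult_ac)
  then show ?thesis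
    using * \<open>\<sigma> * \<sigma> = 1\<close> by simp
qed

text \<open>Second Frenet equation. The linear map \<open>?h\<close> sends \<open>\<tau>\<close> to
  \<open>\<nu>\<close> and squares to minus the identity, so applying it to the first equation gives
  the second.\<close>

lemma ds_normal: "ds \<gamma> \<nu> u = - \<kappa> u *\<^sub>R \<tau> u"
proof -
  obtain \<sigma> where \<sigma>: "\<sigma> * \<sigma> = 1" "\<nu> = (\<lambda>u. \<sigma> *\<^sub>R rot (\<tau> u))"
    using normal_eq_rot by metis
  let ?h = "\<lambda>v. \<sigma> *\<^sub>R rot v"
  have bl: "bounded_linear ?h"
    by (rule bounded_linear_const_scaleR[OF bounded_linear_rot])
  have "(\<nu> has_vector_derivative ?h (speed \<gamma> u *\<^sub>R ds \<gamma> \<tau> u)) (at u)"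
    unfolding \<sigma>(2)
    by (rule bounded_linear.has_vector_derivative[OF bl has_vector_derivative_ds[OF regular smooth_tangent]])
  also have "?h (speed \<gamma> u *\<^sub>R ds \<gamma> \<tau> u) = speed \<gamma> u *\<^sub>R ?h (\<kappa> u *\<^sub>R \<nu> u)"
    by (simp only: linear_scale[OF bounded_linear.linear[OF bl]] ds_tangent)
  also have "?h (\<kappa> u *\<^sub>R \<nu> u) = \<kappa> u *\<^sub>R ?h (?h (\<tau> u))"
    using linear_scale[OF bounded_linear.linear[OF bl], of "\<kappa> u" "\<nu> u"] \<sigma>(2) by simp
  also have "?h (?h (\<tau> u)) = - ((\<sigma> * \<sigma>) *\<^sub>R \<tau> u)"
    by (simp add: linear_scale[OF bounded_linear.linear[OF bounded_linear_rot]] rot_rot)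
  finally have "(\<nu> has_vector_derivative speed \<gamma> u *\<^sub>R (- \<kappa> u *\<^sub>R \<tau> u)) (at u)"
    using \<sigma>(1) by simp
  then show ?thesis
    by (rule ds_eqI[OF regular])
qed

lemmas deriv_curve = has_vector_derivative_ds[OF regular smooth_curve]
lemmas deriv_tangent = has_vector_derivative_ds[OF regular smooth_tangent, unfolded ds_tangent]
lemmas deriv_normal = has_vector_derivative_ds[OF regular smooth_normal, unfolded ds_normal]
lemmas deriv_curvature = has_vector_derivative_ds[OF regular smooth_curvature]

text \<open>In arc length, the product \<open>\<kappa> \<kappa>\<^sub>s\<close> contributes
  \<open>\<kappa>\<^sub>s\<^sup>2\<close> and \<open>\<kappa> \<kappa>\<^sub>s\<^sub>s\<close>. By
  the rotator equation the latter is -2S \<open>\<kappa>\<close> (\<open>\<tau>\<close> .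
  \<open>\<gamma>\<close>), which cancels against the derivative of the support term, as
  \<open>\<nu>\<close> is orthogonal to \<open>\<tau>\<close>. The factor
  \<open>speed \<gamma> u\<close> converts to the parameter u.\<close>

lemma deriv_end_quantity:
  assumes "rotator \<gamma> \<nu> S"
  shows "(end_quantity \<gamma> \<nu> S has_real_derivative speed \<gamma> u * (ds \<gamma> \<kappa> u)\<^sup>2) (at u)"
proof -
  let ?k = "ds \<gamma> \<kappa>"
  have rot: "ds \<gamma> ?k u = - 2 * S * (\<tau> u \<bullet> \<gamma> u)"
    using assms unfolding rotator_def by (metis minus_mult_left minus_minus)
  have "(?k has_vector_derivative speed \<gamma> u *\<^sub>R ds \<gamma> ?k u) (at u)"
    by (rule has_vector_derivative_ds[OF regular smooth_ds[OF regular smooth_curvature]])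
  then have "((\<lambda>u. \<kappa> u * ?k u) has_real_derivative
      \<kappa> u * (speed \<gamma> u * ds \<gamma> ?k u) + speed \<gamma> u * ?k u * ?k u) (at u)"
    using deriv_curvature[of u] unfolding has_real_derivative_iff_has_vector_derivative
    by (auto intro!: derivative_eq_intros)
  moreover have "((\<lambda>u. \<nu> u \<bullet> \<gamma> u) has_real_derivative
      \<nu> u \<bullet> (speed \<gamma> u *\<^sub>R \<tau> u) + (speed \<gamma> u *\<^sub>R (- \<kappa> u *\<^sub>R \<tau> u)) \<bullet> \<gamma> u) (at u)"
    unfolding has_real_derivative_iff_has_vector_derivative
    by (rule bounded_bilinear.has_vector_derivative[OF bounded_bilinear_inner deriv_normal deriv_curve])
  ultimately show ?thesis
    unfolding end_quantity_def[abs_def]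
    by (rule DERIV_cong[OF DERIV_diff[OF _ DERIV_cmult]])
      (simp add: rot normal_orth algebra_simps power2_eq_square)
qed

lemma curvature_constant:
  assumes "rotator \<gamma> \<nu> S"
    and "(\<lambda>i. end_quantity \<gamma> \<nu> S (- real i) - end_quantity \<gamma> \<nu> S (real i)) \<longlonglongrightarrow> 0"
  shows "\<kappa> u = \<kappa> v"
proof (rule zero_vector_derivative_imp_const[of \<kappa>])
  fix x
  have "speed \<gamma> x * (ds \<gamma> \<kappa> x)\<^sup>2 = 0"
    by (rule const_of_DERIV_nonneg_of_ends[OF deriv_end_quantity[OF assms(1)] _ assms(2)])
      (simp add: speed_def)
  then show "(\<kappa> has_vector_derivative 0) (at x)"
    using deriv_curvature[of x] speed_pos[OF regular, of x] by simp
qed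

end

subsection \<open>Arc length of a complete curve\<close>

lemma arc_length_function:
  assumes "regular_immersion \<gamma>" and "complete_curve \<gamma>"
  obtains s where "\<And>u. (s has_real_derivative speed \<gamma> u) (at u)"
    and "filterlim s at_top at_top" and "filterlim s at_bot at_bot"
proof -
  have "smooth (\<lambda>u. vector_derivative \<gamma> (at u))"
    using assms(1) smooth_vector_derivative unfolding regular_immersion_def by blast
  then have "continuous_on UNIV (speed \<gamma>)"
    unfolding speed_def[abs_def] by (intro continuous_on_norm continuous_on_smooth)
  \<comment> \<open>An antiderivative on the whole line is taken because
    \<open>integral {0..u} (speed \<gamma>)\<close> is zero for negative u.\<close>
  then obtain s where s: "\<And>u. (s has_vector_derivative speed \<gamma> u) (at u)"
    using einterval_antiderivative[of "-\<infinity>" "\<infinity>" "speed \<gamma>"]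
    by (auto simp: continuous_on_eq_continuous_at)
  have int: "integral {a..b} (speed \<gamma>) = s b - s a" if "a \<le> b" for a b
    using fundamental_theorem_of_calculus[OF that, of s "speed \<gamma>"] s
      has_vector_derivative_at_within by blast
  \<comment> \<open>The identity \<open>int\<close> needs ordered endpoints, so each end is treated
    on its own side of 0, where the length integral eventually equals a difference of values of
    \<open>s\<close>.\<close>
  have "filterlim (\<lambda>b. s b - s 0) at_top at_top"
    using assms(2) unfolding complete_curve_def
    by (elim conjE filterlim_mono_eventually)
      (auto intro!: eventually_mono[OF eventually_ge_at_top[of 0]] simp: int)
  then have top: "filterlim s at_top at_top"
    using filterlim_tendsto_add_at_top[OF tendsto_const[of "s 0"]] by fastforce
  have "filterlim (\<lambda>a. s 0 - s a) at_top at_bot"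
    using assms(2) unfolding complete_curve_def
    by (elim conjE filterlim_mono_eventually)
      (auto intro!: eventually_mono[OF eventually_le_at_bot[of 0]] simp: int)
  then have "filterlim (\<lambda>a. - s a) at_top at_bot"
    using filterlim_tendsto_add_at_top[OF tendsto_const[of "- s 0"]] by fastforce
  then have "filterlim s at_bot at_bot"
    by (simp add: filterlim_uminus_at_bot)
  then show thesis
    by (intro that[OF _ top]) (simp_all add: s has_real_derivative_iff_has_vector_derivative)
qed

section \<open>Intermediate values and periodic parametrizations\<close>

lemma IVT_at_top:
  fixes s :: "real \<Rightarrow> real"
  assumes "continuous_on UNIV s" and "filterlim s at_top at_top" and "s a \<le> y"
  obtains u where "a \<le> u" and "s u = y"
proof -
  have "eventually (\<lambda>u. y \<le> s u \<and> a \<le> u) at_top"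
    using assms(2) eventually_ge_at_top[of a] by (simp add: filterlim_at_top eventually_conj_iff)
  then obtain b where "y \<le> s b" "a \<le> b"
    by (auto dest!: eventually_happens)
  moreover have "continuous_on {a..b} s"
    by (rule continuous_on_subset[OF assms(1)]) simp
  ultimately show thesis
    using IVT'[of s a y b] assms(3) that by blast
qed

lemma surj_of_filterlim:
  fixes s :: "real \<Rightarrow> real"
  assumes "continuous_on UNIV s" and "filterlim s at_top at_top" and "filterlim s at_bot at_bot"
  shows "surj s"
proof -
  have "\<exists>u. s u = y" for y
  proof -
    have "eventually (\<lambda>a. s a \<le> y) at_bot"
      using assms(3) by (simp add: filterlim_at_bot)
    then obtain a where "s a \<le> y"
      by (auto dest!: eventually_happens)
    then obtain u where "s u = y"
      by (rule IVT_at_top[OF assms(1,2)])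
    then show ?thesis ..
  qed
  then show ?thesis by (metis surj_def)
qed

text \<open>Every value of a periodic function is taken on the fundamental domain from
  \<open>a\<close> to \<open>a + P\<close>. The domain is half-open, which later keeps a point away
  from an excluded endpoint.\<close>

lemma periodic_shift:
  fixes G :: "real \<Rightarrow> 'a"
  assumes "\<And>x. G (x + P) = G x" and "0 < P"
  obtains t where "a \<le> t" and "t < a + P" and "G t = G x"
proof -
  have per: "G (y + real n * P) = G y" for y n
    by (induction n) (use assms(1) in \<open>auto simp: algebra_simps\<close>, metis add.assoc add.commute)
  have per': "G (y + of_int k * P) = G y" for y and k :: int
  proof (cases k)
    case (nonneg n)
    then show ?thesis using per[of y n] by simp
  next
    case (neg n)
    \<comment> \<open>The negative case encodes k as -(n + 1), hence \<open>Suc n\<close> periods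
      lead back to \<open>y\<close>.\<close>
    then have "real_of_int k = - real (Suc n)"
      by simp
    then have "y + of_int k * P + real (Suc n) * P = y"
      by (simp only:)
    with per[of "y + of_int k * P" "Suc n"] show ?thesis
      by (simp only:)
  qed
  define k where "k = \<lfloor>(x - a) / P\<rfloor>"
  have "of_int k \<le> (x - a) / P" "(x - a) / P < of_int k + 1"
    by (auto simp: k_def)
  then have "of_int k * P \<le> x - a" "x - a < (of_int k + 1) * P"
    using assms(2) by (simp_all add: field_simps)
  then show thesis
    using that[of "x + of_int (- k) * P"] per'[of x "- k"] by (simp add: algebra_simps)
qed

text \<open>The half-line from 0 and a bounded interval ending just before 0 are both mapped by
  \<open>s\<close> onto sets containing a full period, so both have the whole range of
  \<open>G\<close> as image.\<close>

lemma not_open_curve_if_periodic: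
  fixes s :: "real \<Rightarrow> real"
  assumes \<gamma>: "\<And>u. \<gamma> u = G (s u)" and per: "\<And>x. G (x + P) = G x" and "0 < P"
    and s: "continuous_on UNIV s" "filterlim s at_top at_top" "filterlim s at_bot at_bot"
  shows "\<not> open_curve \<gamma>"
proof -
  \<comment> \<open>The left endpoint is chosen so far back that \<open>s\<close> grows by at least
    one period between \<open>a\<close> and 0.\<close>
  have "eventually (\<lambda>u. s u \<le> s 0 - P \<and> u \<le> 0) at_bot"
    using s(3) eventually_le_at_bot[of 0] by (simp add: filterlim_at_bot eventually_conj_iff)
  then obtain a where a: "s a \<le> s 0 - P" "a \<le> 0"
    by (auto dest!: eventually_happens)
  have "G x \<in> \<gamma> ` {0..}" for x
  proof -
    obtain t where t: "s 0 \<le> t" "G t = G x"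
      by (rule periodic_shift[of G P, OF per \<open>0 < P\<close>])
    obtain u where "0 \<le> u" "s u = t"
      by (rule IVT_at_top[OF s(1,2) t(1)])
    then show ?thesis
      using \<gamma>[of u] t(2) by (intro image_eqI[of _ _ u]) simp_all
  qed
  moreover have "G x \<in> \<gamma> ` {a..<0}" for x
  proof -
    obtain t where t: "s 0 - P \<le> t" "t < s 0" "G t = G x"
      by (rule periodic_shift[of G P, OF per \<open>0 < P\<close>, where a = "s 0 - P"]) simp
    have "continuous_on {a..0} s"
      by (rule continuous_on_subset[OF s(1)]) simp
    then obtain u where u: "a \<le> u" "u \<le> 0" "s u = t"
      using IVT'[of s a t 0] a t(1,2) by auto
    \<comment> \<open>The strict bound \<open>t < s 0\<close> puts \<open>u\<close> in the half-open
      interval, which is disjoint from the half-line.\<close>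
    moreover have "u \<noteq> 0"
      using t(2) u(3) by auto
    ultimately show ?thesis
      using \<gamma>[of u] t(3) by (intro image_eqI[of _ _ u]) simp_all
  qed
  ultimately have "\<gamma> ` {0..} = \<gamma> ` {a..<0}"
    by (intro subset_antisym image_subsetI) (simp_all add: \<gamma>)
  moreover have "emeasure lborel {0::real..} = \<infinity>"
  proof (rule ccontr)
    assume "emeasure lborel {0::real..} \<noteq> \<infinity>"
    \<comment> \<open>A finite measure would lie below some \<open>n\<close>, yet the half-line
      contains an interval of length \<open>n\<close>.\<close>
    then obtain n :: nat where "emeasure lborel {0::real..} < of_nat n"
      using ennreal_Ex_less_of_nat[of "emeasure lborel {0::real..}"] by (auto simp: less_top)
    also have "of_nat n = emeasure lborel {0..real n}"
      by (simp add: ennreal_of_nat_eq_real_of_nat)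
    also have "\<dots> \<le> emeasure lborel {0::real..}"
      by (rule emeasure_mono) auto
    finally show False by simp
  qed
  moreover have "{0..} \<inter> {a..<0} = {}" "is_interval {0::real..}" "is_interval {a..<0}"
    by (auto simp: is_interval_1)
  moreover have "emeasure lborel {a..<0} < \<infinity>"
    using a(2) by simp
  ultimately show ?thesis
    unfolding open_curve_def by blast
qed

section \<open>Constant curvature: lines and circles\<close>

context framed_curve
begin

text \<open>With zero curvature the tangent is a constant \<open>t\<close>, so
  \<open>\<gamma>\<close> is affine in \<open>s\<close> with direction \<open>t\<close>.
  Surjectivity of \<open>s\<close> makes the image the full line and not only a segment or a
  ray.\<close>

lemma straight_line_if_flat:
  assumes "\<And>u. \<kappa> u = 0"
    and s: "\<And>u. (s has_real_derivative speed \<gamma> u) (at u)" "surj s"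
  shows "straight_line (range \<gamma>)"
proof -
  define t where "t = \<tau> 0"
  have "(\<tau> has_vector_derivative 0) (at u)" for u
    using deriv_tangent[of u] assms(1) by simp
  then have \<tau>: "\<tau> u = t" for u
    unfolding t_def by (rule zero_vector_derivative_imp_const)
  have "((\<lambda>u. \<gamma> u - s u *\<^sub>R t) has_vector_derivative 0) (at u)" for u
    using deriv_curve[of u] s(1)[of u] \<tau>[of u]
    by (auto intro!: derivative_eq_intros simp: has_real_derivative_iff_has_vector_derivative)
  then have "\<gamma> u - s u *\<^sub>R t = \<gamma> 0 - s 0 *\<^sub>R t" for u
    by (rule zero_vector_derivative_imp_const)
  then obtain c where c: "\<And>u. \<gamma> u = c + s u *\<^sub>R t"
    by (metis diff_eq_eq add.commute)
  have "range \<gamma> = range (\<lambda>x. c + x *\<^sub>R t)"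
    unfolding c using image_image[of "\<lambda>x. c + x *\<^sub>R t" s UNIV] \<open>surj s\<close> by simp
  also have "\<dots> = affine hull {c, c + t}"
  proof -
    have "{a *\<^sub>R c + b *\<^sub>R (c + t) | a b. a + b = 1} = range (\<lambda>x. c + x *\<^sub>R t)"
    proof (intro set_eqI iffI)
      fix y assume "y \<in> {a *\<^sub>R c + b *\<^sub>R (c + t) | a b. a + b = 1}"
      then obtain a b where "a + b = 1" "y = a *\<^sub>R c + b *\<^sub>R (c + t)" by blast
      then have "y = c + b *\<^sub>R t"
        by (simp add: algebra_simps flip: scaleR_add_left)
      then show "y \<in> range (\<lambda>x. c + x *\<^sub>R t)" by blast
    next
      fix y assume "y \<in> range (\<lambda>x. c + x *\<^sub>R t)"
      then obtain x where "y = (1 - x) *\<^sub>R c + x *\<^sub>R (c + t)"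
        by (auto simp: algebra_simps)
      moreover have "(1 - x) + x = 1" by simp
      ultimately show "y \<in> {a *\<^sub>R c + b *\<^sub>R (c + t) | a b. a + b = 1}" by blast
    qed
    then show ?thesis by (simp add: affine_hull_2)
  qed
  finally have "range \<gamma> = affine hull {c, c + t}" .
  moreover have "t \<noteq> 0"
    using tangent_unit[of 0] unfolding t_def by auto
  ultimately show ?thesis
    by (simp add: straight_line_def aff_dim_2)
qed

text \<open>Solving the Frenet equations with constant curvature explicitly writes
  \<open>\<gamma>\<close> as a periodic function of arc length, to which the obstruction for
  periodic curves applies.\<close>

lemma not_open_if_constant_curvature:
  assumes k: "\<And>u. \<kappa> u = k" "k \<noteq> 0"
    and s: "\<And>u. (s has_real_derivative speed \<gamma> u) (at u)"
      "filterlim s at_top at_top" "filterlim s at_bot at_bot"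
  shows "\<not> open_curve \<gamma>"
proof -
  note sv = s(1)[unfolded has_real_derivative_iff_has_vector_derivative]
  have cos: "((\<lambda>u. cos (k * s u)) has_real_derivative - (k * speed \<gamma> u * sin (k * s u))) (at u)"
    and sin: "((\<lambda>u. sin (k * s u)) has_real_derivative k * speed \<gamma> u * cos (k * s u)) (at u)" for u
    using s(1)[of u] by (auto intro!: derivative_eq_intros)
  \<comment> \<open>This is the centre of the osculating circle; its derivative is a multiple of
    \<open>1 - \<kappa> u / k\<close>.\<close>
  have "((\<lambda>u. \<gamma> u + (1 / k) *\<^sub>R \<nu> u) has_vector_derivative 0) (at u)" for u
    using deriv_curve[of u] deriv_normal[of u] k by (auto intro!: derivative_eq_intros)
  then have c: "\<gamma> u + (1 / k) *\<^sub>R \<nu> u = \<gamma> 0 + (1 / k) *\<^sub>R \<nu> 0" (is "_ = ?c") for u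
    by (rule zero_vector_derivative_imp_const)
  \<comment> \<open>The frame turns by the angle \<open>k * s u\<close>; \<open>?A\<close> and
    \<open>?B\<close> are the frame turned back by that angle, hence constant.\<close>
  let ?A = "\<lambda>u. cos (k * s u) *\<^sub>R \<tau> u - sin (k * s u) *\<^sub>R \<nu> u"
  let ?B = "\<lambda>u. sin (k * s u) *\<^sub>R \<tau> u + cos (k * s u) *\<^sub>R \<nu> u"
  have "(?A has_vector_derivative 0) (at u)" for u
    by (rule has_vector_derivative_eq_rhs,
        rule has_vector_derivative_diff[OF has_vector_derivative_scaleR has_vector_derivative_scaleR,
          OF cos deriv_tangent sin deriv_normal])
      (simp add: k(1) algebra_simps)
  then have A: "?A u = ?A 0" for u
    by (rule zero_vector_derivative_imp_const)
  have "(?B has_vector_derivative 0) (at u)" for u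
    by (rule has_vector_derivative_eq_rhs,
        rule has_vector_derivative_add[OF has_vector_derivative_scaleR has_vector_derivative_scaleR,
          OF sin deriv_tangent cos deriv_normal])
      (simp add: k(1) algebra_simps)
  then have B: "?B u = ?B 0" for u
    by (rule zero_vector_derivative_imp_const)
  have \<nu>: "\<nu> u = cos (k * s u) *\<^sub>R ?B 0 - sin (k * s u) *\<^sub>R ?A 0" for u
  proof -
    have "cos (k * s u) *\<^sub>R ?B u - sin (k * s u) *\<^sub>R ?A u
        = ((cos (k * s u))\<^sup>2 + (sin (k * s u))\<^sup>2) *\<^sub>R \<nu> u"
      by (simp only: scaleR_add_left scaleR_add_right scaleR_diff_right scaleR_scaleR
          power2_eq_square) (simp add: mult.commute)
    then show ?thesis
      unfolding A[of u] B[of u] by simp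
  qed
  \<comment> \<open>The circle about \<open>?c\<close> of radius \<open>1 / \<bar>k\<bar>\<close>,
    parametrized by arc length.\<close>
  define G where "G x = ?c - (1 / k) *\<^sub>R (cos (k * x) *\<^sub>R ?B 0 - sin (k * x) *\<^sub>R ?A 0)" for x
  show ?thesis
  proof (rule not_open_curve_if_periodic)
    show "\<gamma> u = G (s u)" for u
      using c[of u] unfolding G_def \<nu>[of u, symmetric] by (simp add: algebra_simps)
    show "G (x + 2 * pi / \<bar>k\<bar>) = G x" for x
    proof -
      \<comment> \<open>The absolute value keeps the period positive; the sign of \<open>k\<close>
        only decides the sense of the full turn.\<close>
      have "k * (x + 2 * pi / \<bar>k\<bar>) = (if k > 0 then k * x + 2 * pi else k * x - 2 * pi)"
        using k(2) by (auto simp: field_simps)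
      then show ?thesis
        by (simp add: G_def sin_diff cos_diff)
    qed
    show "continuous_on UNIV s"
      using s(1) by (meson DERIV_isCont continuous_at_imp_continuous_on)
  qed (use k(2) s in auto)
qed

end

theorem proposition15:
  fixes \<gamma> \<nu> :: "real \<Rightarrow> real^2" and S :: real
  assumes "open_curve \<gamma>"
    and "complete_curve \<gamma>"
    and "unit_normal \<gamma> \<nu>"
    and "rotator \<gamma> \<nu> S"
    and "\<And>p q :: nat \<Rightarrow> real.
           filterlim p at_bot sequentially \<Longrightarrow> filterlim q at_top sequentially \<Longrightarrow>
           (\<lambda>i. end_quantity \<gamma> \<nu> S (p i) - end_quantity \<gamma> \<nu> S (q i)) \<longlonglongrightarrow> 0"
  shows "straight_line (range \<gamma>)"
proof -
  have reg: "regular_immersion \<gamma>"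
    using assms(1) by (simp add: open_curve_def)
  interpret framed_curve \<gamma> \<nu>
    by unfold_locales fact+
  have "(\<lambda>i. end_quantity \<gamma> \<nu> S (- real i) - end_quantity \<gamma> \<nu> S (real i)) \<longlonglongrightarrow> 0"
    using filterlim_real_sequentially
    by (intro assms(5)) (simp_all add: filterlim_uminus_at_bot)
  then have const: "\<kappa> u = \<kappa> 0" for u
    by (rule curvature_constant[OF assms(4)])
  \<comment> \<open>Completeness enters here: unbounded arc length at both ends serves to exclude
    circles and to fill the line.\<close>
  obtain s where s: "\<And>u. (s has_real_derivative speed \<gamma> u) (at u)"
    "filterlim s at_top at_top" "filterlim s at_bot at_bot"
    using arc_length_function[OF reg assms(2)] by metis
  have "continuous_on UNIV s"
    using s(1) by (meson DERIV_isCont continuous_at_imp_continuous_on)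
  then have "surj s"
    using s(2,3) by (rule surj_of_filterlim)
  moreover have "\<kappa> 0 = 0"
    using not_open_if_constant_curvature[OF const _ s] assms(1) by blast
  ultimately show ?thesis
    using straight_line_if_flat[OF _ s(1)] const by simp
qed

end
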